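(* Let $(X,\tau)$ be a $T_0$-space. The following two conditions are equivalent: (1) $(X,\tau)$ is a strong $R$-space; (2) every nonempty closed subset of $(X,\tau)$ is a compact saturated subset of $(X,\tau^{d})$, i.e. $\Gamma((X,\tau))\setminus\{\emptyset\}\subseteq Q((X,\tau^{d}))$.
   Context: For a $T_0$-space $X$: a subset is saturated if it equals the intersection of all open sets containing it; $\Gamma(X)$ is the set of all closed subsets of $X$; $Q(X)$ is the set of all nonempty compact saturated subsets of $X$ (compactness is the open-cover property, no separation is included). $X$ is a strong $R$-space if for every nonempty family $\{K_i: i\in I\}\subseteq Q(X)$ and every open $U\subseteq X$, $\bigcap_{i\in I}K_i\subseteq U$ implies $\bigcap_{i\in J}K_i\subseteq U$ for some nonempty finite $J\subseteq I$. The (de Groot) dual $\tau^{d}$ of a $T_0$-topology $\tau$ is the topology on the same set having all compact saturated sets of $(X,\tau)$ as a basis for its closed sets (so its closed sets are exactly the arbitrary intersections of compact saturated sets of $(X,\tau)$, the empty intersection being the whole set). *)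

theory Defs
  imports "HOL-Analysis.Analysis"
begin

text \<open>The inclusion in \<^term>\<open>topspace X\<close> is required explicitly because for
  \<^term>\<open>S\<close> not contained in the space the intersection would be \<^term>\<open>UNIV\<close>.\<close>

definition saturatedin :: "'a topology \<Rightarrow> 'a set \<Rightarrow> bool" where
  "saturatedin X S \<longleftrightarrow> S \<subseteq> topspace X \<and> S = \<Inter>{U. openin X U \<and> S \<subseteq> U}"

definition compact_saturated_in :: "'a topology \<Rightarrow> 'a set \<Rightarrow> bool" where
  "compact_saturated_in X K \<longleftrightarrow> compactin X K \<and> saturatedin X K"

definition closed_subsets :: "'a topology \<Rightarrow> 'a set set" where
  "closed_subsets X = {C. closedin X C}"

definition Q_sets :: "'a topology \<Rightarrow> 'a set set" where
  "Q_sets X = {K. K \<noteq> {} \<and> compact_saturated_in X K}"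

definition strong_R_space :: "'a topology \<Rightarrow> bool" where
  "strong_R_space X \<longleftrightarrow>
     t0_space X \<and>
     (\<forall>\<K> U. \<K> \<noteq> {} \<and> \<K> \<subseteq> Q_sets X \<and> openin X U \<and> \<Inter>\<K> \<subseteq> U \<longrightarrow>
        (\<exists>\<J>. \<J> \<subseteq> \<K> \<and> finite \<J> \<and> \<J> \<noteq> {} \<and> \<Inter>\<J> \<subseteq> U))"

text \<open>The intersection with \<^term>\<open>topspace X\<close> makes the empty family contribute
  the whole space. The empty set is compact saturated, so it may occur in \<open>\<K>\<close>.\<close>

definition de_groot_closed :: "'a topology \<Rightarrow> 'a set \<Rightarrow> bool" where
  "de_groot_closed X C \<longleftrightarrow>
     (\<exists>\<K>. (\<forall>K\<in>\<K>. compact_saturated_in X K) \<and> C = topspace X \<inter> \<Inter>\<K>)"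

definition de_groot_dual :: "'a topology \<Rightarrow> 'a topology" where
  "de_groot_dual X =
     topology (\<lambda>U. U \<subseteq> topspace X \<and> de_groot_closed X (topspace X - U))"

lemma saturatedin_iff:
  "saturatedin X S \<longleftrightarrow>
     S \<subseteq> topspace X \<and> (\<forall>x. x \<notin> S \<longrightarrow> (\<exists>U. openin X U \<and> S \<subseteq> U \<and> x \<notin> U))"
  (is "_ \<longleftrightarrow> ?R")
proof
  assume S: "saturatedin X S"
  have "\<exists>U. openin X U \<and> S \<subseteq> U \<and> x \<notin> U" if "x \<notin> S" for x
  proof -
    have "S = \<Inter>{U. openin X U \<and> S \<subseteq> U}"
      using S unfolding saturatedin_def by (rule conjunct2)
    with that have "x \<notin> \<Inter>{U. openin X U \<and> S \<subseteq> U}"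
      by (rule back_subst[of "\<lambda>A. x \<notin> A"])
    then show ?thesis
      by simp
  qed
  then show ?R
    using S by (simp add: saturatedin_def)
next
  assume R: ?R
  have "\<Inter>{U. openin X U \<and> S \<subseteq> U} \<subseteq> S"
    using R by fast
  then show "saturatedin X S"
    using R unfolding saturatedin_def by (intro conjI subset_antisym Inter_greatest) auto
qed

lemma saturatedin_Un:
  assumes K: "saturatedin X K" and L: "saturatedin X L"
  shows "saturatedin X (K \<union> L)"
  unfolding saturatedin_iff
proof (intro conjI allI impI)
  show "K \<union> L \<subseteq> topspace X"
    using assms by (simp add: saturatedin_iff)
  fix x
  assume x: "x \<notin> K \<union> L"
  obtain U where "openin X U" "K \<subseteq> U" "x \<notin> U"
    using K x unfolding saturatedin_iff by auto
  moreover obtain V where "openin X V" "L \<subseteq> V" "x \<notin> V"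
    using L x unfolding saturatedin_iff by auto
  ultimately show "\<exists>W. openin X W \<and> K \<union> L \<subseteq> W \<and> x \<notin> W"
    by (intro exI[of _ "U \<union> V"]) auto
qed

lemma compact_saturated_in_Un:
  "compact_saturated_in X K \<Longrightarrow> compact_saturated_in X L \<Longrightarrow> compact_saturated_in X (K \<union> L)"
  by (simp add: compact_saturated_in_def compactin_Un saturatedin_Un)

lemma compact_saturated_in_empty: "compact_saturated_in X {}"
  by (auto simp: compact_saturated_in_def saturatedin_iff intro: exI[of _ "{}"])

lemma de_groot_closed_Un:
  assumes "de_groot_closed X C" "de_groot_closed X D"
  shows "de_groot_closed X (C \<union> D)"
proof -
  obtain \<K> \<L> where K: "\<forall>K\<in>\<K>. compact_saturated_in X K" "C = topspace X \<inter> \<Inter>\<K>"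
    and L: "\<forall>L\<in>\<L>. compact_saturated_in X L" "D = topspace X \<inter> \<Inter>\<L>"
    using assms unfolding de_groot_closed_def by blast
  let ?M = "{K \<union> L | K L. K \<in> \<K> \<and> L \<in> \<L>}"
  have "C \<union> D = topspace X \<inter> \<Inter>?M"
    unfolding K(2) L(2) by (auto; blast)
  moreover have "\<forall>M\<in>?M. compact_saturated_in X M"
    using K(1) L(1) compact_saturated_in_Un by blast
  ultimately show ?thesis
    unfolding de_groot_closed_def by blast
qed

lemma de_groot_closed_Inter:
  assumes "\<And>C. C \<in> \<C> \<Longrightarrow> de_groot_closed X C"
  shows "de_groot_closed X (topspace X \<inter> \<Inter>\<C>)"
proof -
  let ?M = "{K. compact_saturated_in X K \<and> topspace X \<inter> \<Inter>\<C> \<subseteq> K}"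
  have "x \<in> C" if "x \<in> topspace X" "x \<in> \<Inter>?M" "C \<in> \<C>" for x C
  proof -
    obtain \<K> where "\<forall>K\<in>\<K>. compact_saturated_in X K" "C = topspace X \<inter> \<Inter>\<K>"
      using assms[OF \<open>C \<in> \<C>\<close>] unfolding de_groot_closed_def by blast
    then show ?thesis
      using that by blast
  qed
  then have "topspace X \<inter> \<Inter>\<C> = topspace X \<inter> \<Inter>?M"
    by (intro subset_antisym subsetI IntI InterI) auto
  moreover have "\<forall>K\<in>?M. compact_saturated_in X K"
    by simp
  ultimately show ?thesis
    unfolding de_groot_closed_def by (intro exI[of _ ?M] conjI)
qed

lemma istopology_de_groot:
  "istopology (\<lambda>U. U \<subseteq> topspace X \<and> de_groot_closed X (topspace X - U))"
  unfolding istopology_def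
proof (intro conjI allI impI)
  fix S T
  assume "S \<subseteq> topspace X \<and> de_groot_closed X (topspace X - S)"
    and "T \<subseteq> topspace X \<and> de_groot_closed X (topspace X - T)"
  then show "S \<inter> T \<subseteq> topspace X" "de_groot_closed X (topspace X - S \<inter> T)"
    by (auto simp: Diff_Int de_groot_closed_Un)
next
  fix \<U>
  assume *: "\<forall>U\<in>\<U>. U \<subseteq> topspace X \<and> de_groot_closed X (topspace X - U)"
  then show "\<Union>\<U> \<subseteq> topspace X"
    by blast
  have "de_groot_closed X (topspace X \<inter> \<Inter>((\<lambda>U. topspace X - U) ` \<U>))"
    using * by (intro de_groot_closed_Inter) auto
  moreover have "topspace X \<inter> \<Inter>((\<lambda>U. topspace X - U) ` \<U>) = topspace X - \<Union>\<U>"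
    by auto
  ultimately show "de_groot_closed X (topspace X - \<Union>\<U>)"
    by (rule back_subst)
qed

lemma openin_de_groot_dual:
  "openin (de_groot_dual X) U \<longleftrightarrow> U \<subseteq> topspace X \<and> de_groot_closed X (topspace X - U)"
  by (simp add: de_groot_dual_def topology_inverse'[OF istopology_de_groot])

lemma topspace_de_groot_dual: "topspace (de_groot_dual X) = topspace X"
proof -
  have "de_groot_closed X {}"
    unfolding de_groot_closed_def by (intro exI[of _ "{{}}"]) (simp add: compact_saturated_in_empty)
  then have "openin (de_groot_dual X) (topspace X)"
    by (simp add: openin_de_groot_dual)
  then show ?thesis
    by (metis openin_de_groot_dual openin_subset openin_topspace subset_antisym)
qed

lemma closedin_de_groot_dual: "closedin (de_groot_dual X) C \<longleftrightarrow> de_groot_closed X C"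
proof -
  have "C \<subseteq> topspace X" if "de_groot_closed X C"
    using that unfolding de_groot_closed_def by blast
  then show ?thesis
    by (auto simp: closedin_def topspace_de_groot_dual openin_de_groot_dual double_diff)
qed

end

theory Submission
  imports Defs
begin

text \<open>Sets of the form \<open>X - K\<close> with \<open>K\<close> compact saturated are a basis of the dual topology, and
  \<open>\<Inter>\<K> \<subseteq> U\<close> says that the sets \<open>X - K\<close> with \<open>K \<in> \<K>\<close> cover the closed set \<open>X - U\<close>. Hence the
  strong \<open>R\<close> property is compactness of closed sets in the dual. Closed sets are always saturated in
  the dual, since a closed set is disjoint from the saturation of any point outside it.\<close>

text \<open>Any open set containing \<open>x\<close> contains the whole intersection, so one member
  of a cover is already a subcover.\<close>

lemma compact_saturated_in_point_saturation:
  assumes "x \<in> topspace X"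
  shows "compact_saturated_in X (\<Inter>{U. openin X U \<and> x \<in> U})" (is "compact_saturated_in X ?K")
  unfolding compact_saturated_in_def
proof
  have sub: "?K \<subseteq> topspace X"
    using assms by blast
  have "\<exists>\<F>. finite \<F> \<and> \<F> \<subseteq> \<U> \<and> ?K \<subseteq> \<Union>\<F>"
    if \<U>: "Ball \<U> (openin X)" "?K \<subseteq> \<Union>\<U>" for \<U>
  proof -
    have "x \<in> \<Union>\<U>"
      using \<U>(2) by blast
    then obtain U where "U \<in> \<U>" "x \<in> U"
      by blast
    with \<U>(1) show ?thesis
      by (intro exI[of _ "{U}"]) auto
  qed
  with sub show "compactin X ?K"
    unfolding compactin_def by blast
  show "saturatedin X ?K"
    unfolding saturatedin_iff using sub by blast
qed

lemma openin_de_groot_dual_Diff: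
  assumes "compact_saturated_in X K"
  shows "openin (de_groot_dual X) (topspace X - K)"
proof -
  have "topspace X - (topspace X - K) = topspace X \<inter> \<Inter>{K}"
    by auto
  then show ?thesis
    unfolding openin_de_groot_dual de_groot_closed_def using assms
    by (intro conjI exI[of _ "{K}"]) auto
qed

text \<open>A dual-closed set is cut out of the space by compact saturated sets, so a point outside
  it is missed by one of them.\<close>

lemma openin_de_groot_dual_basis:
  assumes "openin (de_groot_dual X) U" "x \<in> U"
  obtains K where "compact_saturated_in X K" "topspace X - K \<subseteq> U" "x \<in> topspace X - K"
proof -
  obtain \<K> where \<K>: "\<forall>K\<in>\<K>. compact_saturated_in X K" "topspace X - U = topspace X \<inter> \<Inter>\<K>"
    and "U \<subseteq> topspace X"
    using assms(1) unfolding openin_de_groot_dual de_groot_closed_def by blast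
  then have "x \<in> topspace X" "x \<notin> \<Inter>\<K>"
    using assms(2) by blast+
  then obtain K where "K \<in> \<K>" "x \<notin> K"
    by blast
  with \<K> \<open>x \<in> topspace X\<close> show thesis
    by (intro that[of K]) auto
qed

lemma closedin_imp_saturatedin_de_groot_dual:
  assumes "closedin X C"
  shows "saturatedin (de_groot_dual X) C"
  unfolding saturatedin_iff topspace_de_groot_dual
proof (intro conjI allI impI)
  show C: "C \<subseteq> topspace X"
    using assms by (rule closedin_subset)
  fix x
  assume x: "x \<notin> C"
  show "\<exists>U. openin (de_groot_dual X) U \<and> C \<subseteq> U \<and> x \<notin> U"
  proof (cases "x \<in> topspace X")
    case True
    let ?K = "\<Inter>{U. openin X U \<and> x \<in> U}"
    \<comment> \<open>\<open>topspace X - C\<close> is itself one of the open sets being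
      intersected.\<close>
    have "?K \<subseteq> topspace X - C"
      using assms True x by (intro Inter_lower) auto
    with C have "C \<subseteq> topspace X - ?K"
      by blast
    then show ?thesis
      using openin_de_groot_dual_Diff[OF compact_saturated_in_point_saturation[OF True]] by blast
  next
    \<comment> \<open>For a point outside the space, the whole space serves as the separating open
      set.\<close>
    case False
    then show ?thesis
      using C openin_topspace[of "de_groot_dual X"] unfolding topspace_de_groot_dual by blast
  qed
qed

lemma strong_R_space_imp_compactin_de_groot_dual:
  assumes X: "strong_R_space X" and C: "closedin X C" "C \<noteq> {}"
  shows "compactin (de_groot_dual X) C"
  unfolding compactin_def topspace_de_groot_dual
proof (intro conjI allI impI)
  show sub: "C \<subseteq> topspace X"
    using C(1) by (rule closedin_subset)
  fix \<U>
  assume "Ball \<U> (openin (de_groot_dual X)) \<and> C \<subseteq> \<Union>\<U>"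
  then have \<U>: "\<And>U. U \<in> \<U> \<Longrightarrow> openin (de_groot_dual X) U" "C \<subseteq> \<Union>\<U>"
    by auto
  \<comment> \<open>Members of \<open>\<U>\<close> need not be basic open sets. The complements of
    the sets in \<open>\<K>\<close> are the basic sets that refine \<open>\<U>\<close>, and by
    \<open>avoid\<close> they still cover \<open>C\<close>.\<close>
  define \<K> where "\<K> = {K. compact_saturated_in X K \<and> (\<exists>U\<in>\<U>. topspace X - K \<subseteq> U)}"
  have avoid: "\<exists>K\<in>\<K>. x \<notin> K" if "x \<in> C" for x
  proof -
    obtain U where U: "U \<in> \<U>" "x \<in> U"
      using \<U>(2) \<open>x \<in> C\<close> by blast
    then obtain K where "compact_saturated_in X K" "topspace X - K \<subseteq> U" "x \<in> topspace X - K"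
      using openin_de_groot_dual_basis[OF \<U>(1)] by metis
    then show ?thesis
      using U unfolding \<K>_def by blast
  qed
  show "\<exists>\<F>. finite \<F> \<and> \<F> \<subseteq> \<U> \<and> C \<subseteq> \<Union>\<F>"
  proof (cases "{} \<in> \<K>")
    \<comment> \<open>\<open>Q_sets X\<close> excludes the empty set, so this case is split off: the
      complement of \<open>{}\<close> is the whole space, hence one member of \<open>\<U>\<close>
      covers everything.\<close>
    case True
    then obtain U where "U \<in> \<U>" "topspace X \<subseteq> U"
      unfolding \<K>_def by auto
    then show ?thesis
      using sub by (intro exI[of _ "{U}"]) auto
  next
    case False
    have "\<K> \<noteq> {}"
      using avoid C(2) by blast
    moreover have "\<K> \<subseteq> Q_sets X"
      using False unfolding \<K>_def Q_sets_def by auto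
    moreover have "openin X (topspace X - C)"
      using C(1) by blast
    moreover have "\<Inter>\<K> \<subseteq> topspace X - C"
    proof -
      have "K \<subseteq> topspace X" if "K \<in> \<K>" for K
        using that unfolding \<K>_def compact_saturated_in_def saturatedin_def by blast
      then show ?thesis
        using \<open>\<K> \<noteq> {}\<close> avoid by blast
    qed
    ultimately obtain \<J> where \<J>: "\<J> \<subseteq> \<K>" "finite \<J>" "\<Inter>\<J> \<subseteq> topspace X - C"
      using X unfolding strong_R_space_def by metis
    \<comment> \<open>Back from the refinement to \<open>\<U>\<close>: each of the finitely many
      complements is enlarged to a member of the original cover.\<close>
    have "\<forall>K\<in>\<J>. \<exists>U. U \<in> \<U> \<and> topspace X - K \<subseteq> U"
      using \<J>(1) unfolding \<K>_def by blast
    then obtain u where u: "\<forall>K\<in>\<J>. u K \<in> \<U> \<and> topspace X - K \<subseteq> u K"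
      by metis
    have "C \<subseteq> \<Union>(u ` \<J>)"
      using u \<J>(3) sub by blast
    then show ?thesis
      using u \<J>(2) by (intro exI[of _ "u ` \<J>"]) auto
  qed
qed

text \<open>The complements of the members of \<open>\<K>\<close> form a dual-open cover of
  \<open>topspace X - U\<close>; a finite subcover gives \<open>\<J>\<close>.\<close>

lemma finite_Inter_subset_if_compactin_de_groot_dual:
  assumes C: "compactin (de_groot_dual X) (topspace X - U)" "topspace X - U \<noteq> {}"
    and \<K>: "\<K> \<subseteq> Q_sets X" "\<Inter>\<K> \<subseteq> U"
  shows "\<exists>\<J>. \<J> \<subseteq> \<K> \<and> finite \<J> \<and> \<J> \<noteq> {} \<and> \<Inter>\<J> \<subseteq> U"
proof -
  have cs: "compact_saturated_in X K" if "K \<in> \<K>" for K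
    using that \<K>(1) unfolding Q_sets_def by blast
  have "\<forall>V\<in>(\<lambda>K. topspace X - K) ` \<K>. openin (de_groot_dual X) V"
    using cs openin_de_groot_dual_Diff by auto
  moreover have "topspace X - U \<subseteq> \<Union>((\<lambda>K. topspace X - K) ` \<K>)"
    using \<K>(2) by blast
  ultimately obtain \<F> where \<F>: "finite \<F>" "\<F> \<subseteq> (\<lambda>K. topspace X - K) ` \<K>" "topspace X - U \<subseteq> \<Union>\<F>"
    using C(1) unfolding compactin_def by meson
  then obtain \<J> where \<J>: "\<J> \<subseteq> \<K>" "finite \<J>" "\<F> = (\<lambda>K. topspace X - K) ` \<J>"
    by (metis finite_subset_image)
  \<comment> \<open>An empty family cannot cover the nonempty set
    \<open>topspace X - U\<close>.\<close>
  have "\<J> \<noteq> {}"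
    using C(2) \<F>(3) \<J>(3) by blast
  \<comment> \<open>The cover only controls points of the space; this inclusion and
    \<open>\<J> \<noteq> {}\<close> keep \<open>\<Inter>\<J>\<close> inside it.\<close>
  moreover have "K \<subseteq> topspace X" if "K \<in> \<J>" for K
    using cs \<J>(1) that unfolding compact_saturated_in_def saturatedin_def by blast
  ultimately have "\<Inter>\<J> \<subseteq> U"
    using \<F>(3) \<J>(3) by blast
  with \<J> \<open>\<J> \<noteq> {}\<close> show ?thesis
    by blast
qed

theorem theorem4p9:
  fixes X :: "'a topology"
  assumes "t0_space X"
  shows "strong_R_space X \<longleftrightarrow> closed_subsets X - {{}} \<subseteq> Q_sets (de_groot_dual X)"
proof
  assume "strong_R_space X"
  then show "closed_subsets X - {{}} \<subseteq> Q_sets (de_groot_dual X)"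
    using strong_R_space_imp_compactin_de_groot_dual closedin_imp_saturatedin_de_groot_dual
    unfolding closed_subsets_def Q_sets_def compact_saturated_in_def by blast
next
  assume R: "closed_subsets X - {{}} \<subseteq> Q_sets (de_groot_dual X)"
  have "\<exists>\<J>. \<J> \<subseteq> \<K> \<and> finite \<J> \<and> \<J> \<noteq> {} \<and> \<Inter>\<J> \<subseteq> U"
    if \<K>: "\<K> \<noteq> {}" "\<K> \<subseteq> Q_sets X" "openin X U" "\<Inter>\<K> \<subseteq> U" for \<K> U
  proof (cases "topspace X - U = {}")
    \<comment> \<open>\<open>R\<close> speaks of nonempty closed sets only. Here \<open>U\<close>
      contains the whole space, so any single member of \<open>\<K>\<close> lies in
      \<open>U\<close>.\<close>
    case True
    obtain K where "K \<in> \<K>"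
      using \<K>(1) by blast
    moreover from this have "K \<subseteq> topspace X"
      using \<K>(2) unfolding Q_sets_def compact_saturated_in_def saturatedin_def by blast
    ultimately show ?thesis
      using True by (intro exI[of _ "{K}"]) auto
  next
    case False
    have "closedin X (topspace X - U)"
      using \<K>(3) by blast
    with R False have "compactin (de_groot_dual X) (topspace X - U)"
      unfolding closed_subsets_def Q_sets_def compact_saturated_in_def by blast
    then show ?thesis
      using False \<K> by (intro finite_Inter_subset_if_compactin_de_groot_dual)
  qed
  with assms show "strong_R_space X"
    unfolding strong_R_space_def by blast
qed

end
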